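(* Let $t,n$ be integers such that either $t=2$ and $n\ge 11$, or $t\ge 3$ and $n\ge 9$. Then $$\mathrm{sat}_t(n,\mathcal{C}_2(K_3))=2n-4.$$ Furthermore, if $t\ge 3$ (and $n\ge 9$), then every $n$-vertex $(\mathcal{C}_2(K_3),t)$-saturated graph with exactly $2n-4$ edges has underlying (uncolored) graph isomorphic to the complete bipartite graph $K_{2,n-2}$.
   Context: All graphs are finite and simple. Write $[t]=\{1,\dots,t\}$. A $t$-edge-coloring of a graph $G$ is an arbitrary function $E(G)\to[t]$ (not necessarily proper). Given a family $\mathcal{C}$ of graphs edge-colored from $[t]$, a $t$-edge-colored graph $G$ is $(\mathcal{C},t)$-saturated if $G$ contains no member of $\mathcal{C}$ as a colored subgraph (not necessarily induced, colors matching), but for every non-edge $e\in E(\overline{G})$ and every color $i\in[t]$, adding $e$ to $G$ in color $i$ creates a colored subgraph that is a member of $\mathcal{C}$. The number $\mathrm{sat}_t(n,\mathcal{C})$ is the minimum number of edges in a $(\mathcal{C},t)$-saturated graph on $n$ vertices. For a graph $H$, $\mathcal{C}_r(H)$ is the family of all edge-colorings of $H$ with colors from $[t]$ that use exactly $r$ colors; thus $\mathcal{C}_2(K_3)$ is the family of triangles whose edges receive exactly two colors. *)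

theory Defs
  imports Main "HOL-Library.Extended_Nat"
begin

record 'a graph =
  verts :: "'a set"
  edges :: "'a set set"

text \<open>Only the values of \<^term>\<open>color\<close> on edges matter; the values on other sets are ignored.\<close>

record 'a colored_graph = "'a graph" +
  color :: "'a set \<Rightarrow> nat"

definition simple_graph :: "('a, 'b) graph_scheme \<Rightarrow> bool" where
  "simple_graph G \<longleftrightarrow> finite (verts G) \<and> (\<forall>e\<in>edges G. e \<subseteq> verts G \<and> card e = 2)"

definition non_edges :: "('a, 'b) graph_scheme \<Rightarrow> 'a set set" where
  "non_edges G = {e. e \<subseteq> verts G \<and> card e = 2 \<and> e \<notin> edges G}"

definition edge_colored :: "nat \<Rightarrow> 'a colored_graph \<Rightarrow> bool" where
  "edge_colored t G \<longleftrightarrow> simple_graph G \<and> (\<forall>e\<in>edges G. color G e \<in> {1..t})"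

definition add_edge :: "'a set \<Rightarrow> nat \<Rightarrow> 'a colored_graph \<Rightarrow> 'a colored_graph" where
  "add_edge e i G = G\<lparr>edges := insert e (edges G), color := (color G)(e := i)\<rparr>"

text \<open>A copy of \<open>H\<close> in \<open>G\<close>, not necessarily induced, with exactly the colors of \<open>H\<close>
  (colors may not be permuted).\<close>

definition colored_subgraph :: "'b colored_graph \<Rightarrow> 'a colored_graph \<Rightarrow> bool" where
  "colored_subgraph H G \<longleftrightarrow>
     (\<exists>f. inj_on f (verts H) \<and> f ` verts H \<subseteq> verts G \<and>
          (\<forall>e\<in>edges H. f ` e \<in> edges G \<and> color G (f ` e) = color H e))"

definition saturated :: "'b colored_graph set \<Rightarrow> nat \<Rightarrow> 'a colored_graph \<Rightarrow> bool" where
  "saturated \<C> t G \<longleftrightarrow>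
     edge_colored t G \<and>
     \<not> (\<exists>H\<in>\<C>. colored_subgraph H G) \<and>
     (\<forall>e\<in>non_edges G. \<forall>i\<in>{1..t}. \<exists>H\<in>\<C>. colored_subgraph H (add_edge e i G))"

text \<open>Every \<open>n\<close>-vertex graph has an isomorphic copy with vertices in \<^typ>\<open>nat\<close>. The infimum
  in \<^typ>\<open>enat\<close> is an attained minimum whenever a saturated graph on \<open>n\<close> vertices exists;
  otherwise it is \<open>\<infinity>\<close>, so a finite value includes existence.\<close>

definition sat_number :: "nat \<Rightarrow> nat \<Rightarrow> 'b colored_graph set \<Rightarrow> enat" where
  "sat_number t n \<C> =
     (INF G \<in> {G :: nat colored_graph. saturated \<C> t G \<and> card (verts G) = n}.
        enat (card (edges G)))"

text \<open>The family \<open>\<C>\<^sub>r(H)\<close>, with its dependence on \<open>t\<close> made explicit.\<close>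

definition colorings_using :: "nat \<Rightarrow> nat \<Rightarrow> 'a graph \<Rightarrow> 'a colored_graph set" where
  "colorings_using t r H =
     {\<lparr>verts = verts H, edges = edges H, color = c\<rparr> | c.
        c ` edges H \<subseteq> {1..t} \<and> card (c ` edges H) = r}"

definition complete_graph :: "nat \<Rightarrow> nat graph" where
  "complete_graph m = \<lparr>verts = {..<m}, edges = {e. e \<subseteq> {..<m} \<and> card e = 2}\<rparr>"

definition complete_bipartite :: "nat \<Rightarrow> nat \<Rightarrow> (nat + nat) graph" where
  "complete_bipartite a b =
     \<lparr>verts = Inl ` {..<a} \<union> Inr ` {..<b}, edges = {{Inl i, Inr j} | i j. i < a \<and> j < b}\<rparr>"

definition graph_isomorphic :: "'a graph \<Rightarrow> 'b graph \<Rightarrow> bool" where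
  "graph_isomorphic G H \<longleftrightarrow>
     (\<exists>f. bij_betw f (verts G) (verts H) \<and> (\<lambda>e. f ` e) ` edges G = edges H)"

text \<open>For a colored graph \<open>G\<close>, the underlying uncolored graph is \<^term>\<open>graph.truncate G\<close>.\<close>

end

theory Submission
  imports Defs
begin

text \<open>
  Write \<open>e(S)\<close> for the number of edges inside \<open>S\<close>. A non-edge \<open>uw\<close> of a saturated graph can be added in color
  \<open>i\<close> with the required effect precisely if some common neighbor \<open>z\<close> of \<open>u\<close> and \<open>w\<close> makes \<open>u w z\<close> a
  triangle with two colors (\<open>saturated_iff\<close>). The upper bound is a coloring of \<open>K\<^sub>2\<^sub>,\<^sub>n\<^sub>-\<^sub>2\<close> with two colors
  (\<open>saturated_colored_K2\<close>). The lower bounds start from a vertex \<open>v\<close> of minimum degree \<open>d\<close>, with \<open>D\<close> its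
  neighborhood and \<open>W\<close> the set of vertices outside \<open>D \<union> {v}\<close>, and count
  \<open>d + e(D) + e(W) + \<Sum>w\<in>W. |nb w \<inter> D|\<close> edges.

  For \<open>t \<ge> 3\<close>, non-adjacent vertices have at least two common neighbors: with only one, adding the edge either
  in the color common to the two edges there or in a third color creates no two-colored triangle. Hence each
  vertex of \<open>W\<close> has two neighbors in \<open>D\<close>, which yields \<open>2n - 4\<close> edges and the case of equality
  (\<open>two_common_neighbors_bound\<close>).

  For \<open>t = 2\<close>, one common neighbor may be enough, but the paths of length two between non-adjacent vertices are
  never all monochromatic of the same color. This property alone implies the bound
  (\<open>two_colored_edge_bound\<close>). Degree \<open>d \<ge> 4\<close> is immediate and \<open>d = 0\<close> impossible. For \<open>d = 3\<close>, too few edges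
  would make all estimates tight, so that vertices of \<open>W\<close> have degree three and reach too few vertices in two
  steps once \<open>n \<ge> 11\<close> (\<open>degree_three_bound\<close>). For \<open>d = 1\<close> and \<open>d = 2\<close> the colors force the vertices with a
  single neighbor in \<open>D\<close> into one connected component \<open>A\<close> of \<open>W\<close>, which has at least \<open>|A| - 1\<close> edges. For
  \<open>d = 1\<close> these suffice (\<open>degree_one_bound\<close>). For \<open>d = 2\<close> they leave a deficit of at most one
  (\<open>degree_two_bound\<close>), which occurs only if \<open>A\<close> is a star, and a star with the required colors does not
  exist (\<open>no_spiked_star\<close>).
\<close>

section \<open>Counting edges in finite graphs\<close>

lemma card_edges_between:
  assumes "finite A" "finite B" "A \<inter> B = {}"
  shows "card {{a, b} | a b. a \<in> A \<and> b \<in> B} = card A * card B"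
proof -
  have "{{a, b} | a b. a \<in> A \<and> b \<in> B} = (\<lambda>(a, b). {a, b}) ` (A \<times> B)" by auto
  moreover have "inj_on (\<lambda>(a, b). {a, b}) (A \<times> B)"
    using assms(3) by (auto simp: inj_on_def doubleton_eq_iff)
  ultimately show ?thesis by (simp add: card_image card_cartesian_product)
qed

locale edge_set =
  fixes V :: "'a set" and E :: "'a set set"
  assumes finite_V: "finite V"
    and edgeD: "e \<in> E \<Longrightarrow> e \<subseteq> V \<and> card e = 2"
begin

text \<open>Adjacency is read off the edge set, so \<open>nb u\<close> is meaningful for every \<open>u\<close> and is empty outside
  \<open>V\<close>.\<close>

definition nb :: "'a \<Rightarrow> 'a set" where "nb u = {w. {u, w} \<in> E}"

definition edges_in :: "'a set \<Rightarrow> nat" where "edges_in S = card {e \<in> E. e \<subseteq> S}"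

lemma nb_subset: "nb u \<subseteq> V"
  using edgeD by (auto simp: nb_def)

lemma finite_nb: "finite (nb u)"
  using nb_subset finite_V finite_subset by blast

lemma nb_irrefl: "u \<notin> nb u"
proof
  assume "u \<in> nb u"
  then have "card {u, u} = 2" using edgeD[of "{u, u}"] by (simp add: nb_def)
  then show False by simp
qed

lemma nb_sym: "w \<in> nb u \<longleftrightarrow> u \<in> nb w"
  by (simp add: nb_def insert_commute)

lemma nb_in_V: "w \<in> nb u \<Longrightarrow> u \<in> V \<and> w \<in> V"
  using nb_subset nb_sym by blast

lemma finite_E: "finite E"
  by (rule finite_subset[of _ "Pow V"]) (use edgeD finite_V in auto)

lemma edges_in_V: "edges_in V = card E"
proof -
  have "{e \<in> E. e \<subseteq> V} = E" using edgeD by blast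
  then show ?thesis by (simp add: edges_in_def)
qed

lemma edges_in_mono: "S \<subseteq> T \<Longrightarrow> edges_in S \<le> edges_in T"
  unfolding edges_in_def using finite_E by (intro card_mono) auto

lemma edges_in_insert:
  assumes "x \<notin> S"
  shows "edges_in (insert x S) = edges_in S + card (nb x \<inter> S)"
proof -
  have split: "{e \<in> E. e \<subseteq> insert x S} = {e \<in> E. e \<subseteq> S} \<union> (\<lambda>w. {x, w}) ` (nb x \<inter> S)"
    (is "?L = ?A \<union> ?B")
  proof
    show "?A \<union> ?B \<subseteq> ?L" by (auto simp: nb_def)
    show "?L \<subseteq> ?A \<union> ?B"
    proof
      fix e assume e: "e \<in> ?L"
      show "e \<in> ?A \<union> ?B"
      proof (cases "x \<in> e")
        case True
        from e have "card e = 2" using edgeD by blast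
        with True obtain w where "e = {x, w}" "w \<noteq> x"
          by (auto simp: card_2_iff doubleton_eq_iff)
        then show ?thesis using e by (auto simp: nb_def)
      qed (use e in auto)
    qed
  qed
  have inj: "inj_on (\<lambda>w. {x, w}) (nb x \<inter> S)"
    by (auto simp: inj_on_def doubleton_eq_iff)
  have "card (?A \<union> ?B) = card ?A + card ?B"
    using finite_E finite_nb assms by (intro card_Un_disjoint) auto
  also have "card ?B = card (nb x \<inter> S)" by (rule card_image[OF inj])
  finally show ?thesis unfolding edges_in_def split .
qed

lemma edges_in_empty: "edges_in {} = 0"
proof -
  have "{} \<notin> E" using edgeD[of "{}"] by auto
  then show ?thesis by (simp add: edges_in_def)
qed

lemma edges_in_Un:
  assumes "finite T" "S \<inter> T = {}"
  shows "edges_in (S \<union> T) = edges_in S + edges_in T + (\<Sum>w\<in>T. card (nb w \<inter> S))"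
  using assms
proof (induction T rule: finite_induct)
  case empty
  then show ?case by (simp add: edges_in_empty)
next
  case (insert x T)
  have "card (nb x \<inter> (S \<union> T)) = card (nb x \<inter> S) + card (nb x \<inter> T)"
    unfolding Int_Un_distrib using insert finite_nb by (intro card_Un_disjoint) auto
  then show ?case using insert edges_in_insert[of x "S \<union> T"] edges_in_insert[of x T] by simp
qed

text \<open>Both sides count the edges between \<open>S\<close> and \<open>T\<close>.\<close>

lemma cross_edges_symmetric:
  assumes "finite S" "finite T" "S \<inter> T = {}"
  shows "(\<Sum>w\<in>T. card (nb w \<inter> S)) = (\<Sum>w\<in>S. card (nb w \<inter> T))"
proof -
  have "T \<inter> S = {}" using assms by blast
  then show ?thesis
    using edges_in_Un[of T S] edges_in_Un[of S T] assms by (simp add: Un_commute[of T S])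
qed

lemma handshake:
  assumes "finite S"
  shows "2 * edges_in S = (\<Sum>w\<in>S. card (nb w \<inter> S))"
  using assms
proof (induction S rule: finite_induct)
  case empty
  then show ?case by (simp add: edges_in_empty)
next
  case (insert x S)
  have "(\<Sum>w\<in>S. card (nb w \<inter> insert x S)) =
      (\<Sum>w\<in>S. card (nb w \<inter> S) + (if w \<in> nb x then 1 else 0))"
  proof (rule sum.cong)
    fix w assume "w \<in> S"
    show "card (nb w \<inter> insert x S) = card (nb w \<inter> S) + (if w \<in> nb x then 1 else 0)"
      using insert(2) finite_nb nb_sym[of w x] by (simp add: Int_insert_right)
  qed simp
  also have "\<dots> = 2 * edges_in S + card (nb x \<inter> S)"
    using insert by (simp add: sum.distrib sum.If_cases Int_commute)
  finally show ?case
    using insert edges_in_insert[of x S] nb_irrefl[of x] by (simp add: Int_insert_right)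
qed

text \<open>The count behind the bounds for small minimum degree. The edges are sorted by the partition of \<open>V\<close> into \<open>v\<close>, its
  neighbors and the rest \<open>W\<close>. A vertex of \<open>W\<close> with two neighbors in \<open>nb v\<close> contributes two edges, as a bound
  near \<open>2n\<close> requires; edges inside \<open>W\<close> have to compensate for the vertices with a single neighbor in
  \<open>nb v\<close>.\<close>

lemma card_E_around:
  assumes "v \<in> V"
  defines "W \<equiv> V - insert v (nb v)"
  shows "card E = card (nb v) + edges_in (nb v) + edges_in W + (\<Sum>w\<in>W. card (nb w \<inter> nb v))"
    and "card V = card (nb v) + card W + 1"
proof -
  have V: "V = insert v (nb v) \<union> W" and disj: "insert v (nb v) \<inter> W = {}"
    using assms nb_subset by auto
  have fin: "finite W" using finite_V by (simp add: W_def)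
  have "nb w \<inter> insert v (nb v) = nb w \<inter> nb v" if "w \<in> W" for w
    using that nb_sym by (auto simp: W_def)
  then show "card E = card (nb v) + edges_in (nb v) + edges_in W + (\<Sum>w\<in>W. card (nb w \<inter> nb v))"
    using edges_in_Un[OF fin disj] edges_in_insert[of v "nb v"] nb_irrefl[of v] edges_in_V V
    by simp
  have "card V = card (insert v (nb v)) + card W"
    using card_Un_disjoint[OF _ fin disj] finite_nb V by simp
  then show "card V = card (nb v) + card W + 1"
    using finite_nb nb_irrefl by simp
qed

lemma degree_split:
  assumes "v \<in> V" "w \<in> V - insert v (nb v)"
  shows "card (nb w) = card (nb w \<inter> nb v) + card (nb w \<inter> (V - insert v (nb v)))"
proof -
  have "nb w = (nb w \<inter> nb v) \<union> (nb w \<inter> (V - insert v (nb v)))"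
    using assms nb_subset[of w] nb_sym[of v w] by auto
  then show ?thesis
    using card_Un_disjoint[of "nb w \<inter> nb v" "nb w \<inter> (V - insert v (nb v))"] finite_nb by auto
qed

lemma degree_ge_imp_card_E:
  assumes "\<And>w. w \<in> V \<Longrightarrow> d \<le> card (nb w)"
  shows "d * card V \<le> 2 * card E"
proof -
  have "d * card V = (\<Sum>w\<in>V. d)" by simp
  also have "\<dots> \<le> (\<Sum>w\<in>V. card (nb w \<inter> V))"
    using assms nb_subset by (intro sum_mono) (simp add: Int_absorb2)
  finally show ?thesis using handshake[OF finite_V] edges_in_V by simp
qed

text \<open>The connected component \<open>A\<close> of \<open>u\<close> in the subgraph induced on \<open>W\<close> has at least \<open>|A| - 1\<close> edges. No notion
  of path is involved: a maximal set containing \<open>u\<close> with \<open>|A| \<le> e(A) + 1\<close> admits no edge to the rest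
  of \<open>W\<close>, because adding the other end of such an edge would preserve the inequality.\<close>

lemma component_with_tree_bound:
  assumes "u \<in> W" "W \<subseteq> V"
  obtains A where "u \<in> A" "A \<subseteq> W" "card A \<le> edges_in A + 1" "\<And>a. a \<in> A \<Longrightarrow> nb a \<inter> W \<subseteq> A"
proof -
  let ?P = "\<lambda>A. u \<in> A \<and> A \<subseteq> W \<and> card A \<le> edges_in A + 1"
  have finW: "finite W" using assms finite_V finite_subset by blast
  have "finite {A. ?P A}" using finW by (rule_tac finite_subset[of _ "Pow W"]) auto
  moreover have "{u} \<in> {A. ?P A}" using assms by simp
  ultimately obtain A where A: "?P A" and max: "\<And>B. ?P B \<Longrightarrow> A \<subseteq> B \<Longrightarrow> A = B"
    using finite_has_maximal2[of "{A. ?P A}" "{u}"] by auto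
  have "nb a \<inter> W \<subseteq> A" if "a \<in> A" for a
  proof (rule ccontr)
    assume "\<not> nb a \<inter> W \<subseteq> A"
    then obtain w where w: "w \<in> nb a" "w \<in> W" "w \<notin> A" by blast
    have finA: "finite A" using A finW finite_subset by blast
    have "a \<in> nb w \<inter> A" using w that nb_sym by blast
    then have "0 < card (nb w \<inter> A)" using finA card_gt_0_iff by blast
    then have "?P (insert w A)"
      using A w finA edges_in_insert[of w A] by auto
    then have "A = insert w A" by (rule max) blast
    then show False using w(3) by blast
  qed
  then show ?thesis using A by (intro that[of A]) auto
qed

text \<open>Vertices that are adjacent or have a common neighbor in \<open>W\<close> lie in the same component of \<open>W\<close>.\<close>

lemma linked_component:
  assumes "S \<subseteq> W" "W \<subseteq> V" "S \<noteq> {}"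
    and linked: "\<And>p q. p \<in> S \<Longrightarrow> q \<in> S \<Longrightarrow> p \<noteq> q \<Longrightarrow> q \<notin> nb p \<Longrightarrow> nb p \<inter> nb q \<inter> W \<noteq> {}"
  obtains A where "S \<subseteq> A" "A \<subseteq> W" "card A \<le> edges_in A + 1" "\<And>a. a \<in> A \<Longrightarrow> nb a \<inter> W \<subseteq> A"
proof -
  obtain p where p: "p \<in> S" using assms by blast
  obtain A where A: "p \<in> A" "A \<subseteq> W" "card A \<le> edges_in A + 1" "\<And>a. a \<in> A \<Longrightarrow> nb a \<inter> W \<subseteq> A"
    by (rule component_with_tree_bound[of p W]) (use p assms in auto)
  have "q \<in> A" if q: "q \<in> S" for q
  proof (cases "p = q \<or> q \<in> nb p")
    case True
    then show ?thesis using A q assms(1) by blast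
  next
    case False
    then obtain z where "z \<in> nb p" "z \<in> nb q" "z \<in> W" using linked p q by blast
    then show ?thesis using A q assms(1) nb_sym by blast
  qed
  then have "S \<subseteq> A" by blast
  then show ?thesis by (rule that[OF _ A(2-4)])
qed

section \<open>Bounds from common neighbors\<close>

text \<open>With minimum degree \<open>3\<close>, fewer than \<open>2n - 4\<close> edges force every estimate to be tight: \<open>nb v\<close> is
  independent, each remaining vertex has exactly one neighbor in \<open>nb v\<close> and two in \<open>W\<close>. Then a vertex
  \<open>w \<in> W\<close> attached to \<open>u \<in> nb v\<close> reaches, in two steps, only \<open>8 + |nb u \<inter> W|\<close> vertices. Hence each of the
  three neighbors of \<open>v\<close> has at least \<open>n - 8\<close> neighbors in \<open>W\<close>; these are disjoint sets in a set of size
  \<open>n - 4\<close>, so \<open>n \<le> 10\<close>. The Petersen graph, with \<open>n = 10\<close> and \<open>2n - 5\<close> edges, shows that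
  \<open>11\<close> cannot be lowered here.\<close>

lemma degree_three_bound:
  assumes diam: "\<And>u w. u \<in> V \<Longrightarrow> w \<in> V \<Longrightarrow> u \<noteq> w \<Longrightarrow> w \<notin> nb u \<Longrightarrow> nb u \<inter> nb w \<noteq> {}"
    and min: "\<And>w. w \<in> V \<Longrightarrow> 3 \<le> card (nb w)"
    and v: "v \<in> V" "card (nb v) = 3"
    and n: "11 \<le> card V"
  shows "2 * card V - 4 \<le> card E"
proof (rule ccontr)
  assume less: "\<not> 2 * card V - 4 \<le> card E"
  define W where "W = V - insert v (nb v)"
  define d where "d w = card (nb w \<inter> nb v)" for w
  define f where "f w = card (nb w \<inter> W)" for w
  have finW: "finite W" using finite_V by (simp add: W_def)
  have cV: "card V = card W + 4" and cE: "card E = 3 + edges_in (nb v) + edges_in W + (\<Sum>w\<in>W. d w)"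
    using card_E_around[OF v(1)] v(2) unfolding W_def d_def by simp_all
  have deg: "card (nb w) = d w + f w" if "w \<in> W" for w
    using degree_split[OF v(1)] that unfolding W_def d_def f_def by blast
  have d1: "1 \<le> d w" if "w \<in> W" for w
  proof -
    have "nb v \<inter> nb w \<noteq> {}" using diam v that by (auto simp: W_def)
    then show ?thesis using finite_nb by (simp add: d_def Suc_le_eq card_gt_0_iff Int_commute)
  qed
  have f3: "3 \<le> d w + f w" if "w \<in> W" for w
    using min[of w] deg[OF that] that by (auto simp: W_def)
  have "2 * edges_in W = (\<Sum>w\<in>W. f w)" unfolding f_def by (rule handshake[OF finW])
  then have tot: "2 * edges_in (nb v) + (\<Sum>w\<in>W. f w + 2 * d w) \<le> 4 * card W"
    using less cV cE by (simp add: sum.distrib sum_distrib_left[symmetric])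
  \<comment> \<open>Each \<open>f w + 2 * d w\<close> is at least \<open>3 + d w\<close>, so the total \<open>4 |W|\<close> leaves no slack anywhere.\<close>
  have ge4: "4 \<le> f w + 2 * d w" if "w \<in> W" for w using d1[OF that] f3[OF that] by simp
  have "(\<Sum>w\<in>W. 4) \<le> (\<Sum>w\<in>W. f w + 2 * d w)" by (rule sum_mono) (rule ge4)
  then have indep: "edges_in (nb v) = 0" and eq: "(\<Sum>w\<in>W. f w + 2 * d w) = (\<Sum>w\<in>W. 4)"
    using tot by auto
  have eq4: "f w + 2 * d w = 4" if "w \<in> W" for w
    using sum_mono_inv[OF eq[symmetric] _ that finW] ge4 by simp
  have df: "d w = 1" "f w = 2" if "w \<in> W" for w
    using eq4[OF that] d1[OF that] f3[OF that] by linarith+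
  have cubic: "card (nb w) = 3" if "w \<in> W" for w using df deg that by simp
  have nbD: "nb u \<subseteq> insert v W" if "u \<in> nb v" for u
  proof
    fix z assume z: "z \<in> nb u"
    have "z \<notin> nb v"
    proof
      assume "z \<in> nb v"
      then have "{u, z} \<in> {e \<in> E. e \<subseteq> nb v}" using z that by (auto simp: nb_def)
      then show False using indep finite_E by (auto simp: edges_in_def)
    qed
    then show "z \<in> insert v W" using z nb_subset by (auto simp: W_def)
  qed
  have large: "card V \<le> 8 + card (nb u \<inter> W)" if u: "u \<in> nb v" for u
  proof -
    have "3 \<le> card (nb u)" using min u nb_in_V by blast
    moreover have "card (nb u \<inter> {v}) \<le> 1" using card_mono[of "{v}" "nb u \<inter> {v}"] by simp
    moreover have "nb u = (nb u \<inter> {v}) \<union> (nb u \<inter> W)" using nbD[OF u] by blast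
    then have "card (nb u) \<le> card (nb u \<inter> {v}) + card (nb u \<inter> W)" by (metis card_Un_le)
    ultimately have nbu: "card (nb u) \<le> 1 + card (nb u \<inter> W)" "card (nb u \<inter> W) \<noteq> 0" by auto
    then obtain w where w: "w \<in> nb u" "w \<in> W" by (metis card.empty disjoint_iff)
    have uw: "u \<in> nb w \<inter> nb v" using w u nb_sym by blast
    have Wn: "w \<in> V" using w by (simp add: W_def)
    have "card (nb w \<inter> W) = 2" using df(2)[OF w(2)] by (simp add: f_def)
    then obtain p q where pq: "nb w \<inter> W = {p, q}" by (auto simp: card_2_iff)
    have Wp: "p \<in> W" and Wq: "q \<in> W" and wp: "w \<in> nb p" and wq: "w \<in> nb q"
      using pq nb_sym[of _ w] by blast+
    have "nb w \<inter> nb v = {u}"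
      using df(1)[OF w(2)] uw unfolding d_def by (metis card_1_singletonE singletonD)
    then have nbw: "nb w = {u, p, q}"
      using pq nb_subset[of w] nb_sym[of v w] w(2) by (auto simp: W_def)
    define P Q where "P = nb p - {w}" and "Q = nb q - {w}"
    \<comment> \<open>Every vertex is \<open>w\<close>, adjacent to \<open>w\<close>, or adjacent to one of \<open>u\<close>, \<open>p\<close>, \<open>q\<close>; the vertex \<open>w\<close> itself is
      removed from \<open>P\<close> and \<open>Q\<close> since \<open>nb u\<close> already contains it.\<close>
    have "V \<subseteq> {u, p, q} \<union> nb u \<union> P \<union> Q"
    proof
      fix z assume z: "z \<in> V"
      show "z \<in> {u, p, q} \<union> nb u \<union> P \<union> Q"
      proof (cases "z = w \<or> z \<in> nb w")
        case True
        then show ?thesis using nbw w by auto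
      next
        case False
        then obtain s where "s \<in> nb w" "s \<in> nb z" using diam[OF Wn z] by blast
        then show ?thesis using nbw nb_sym False by (auto simp: P_def Q_def)
      qed
    qed
    then have "card V \<le> card ({u, p, q} \<union> nb u \<union> P \<union> Q)"
      using finite_nb by (intro card_mono) (auto simp: P_def Q_def)
    also have "\<dots> \<le> card {u, p, q} + card (nb u) + card P + card Q"
      using card_Un_le[of "{u, p, q} \<union> nb u \<union> P" Q] card_Un_le[of "{u, p, q} \<union> nb u" P]
        card_Un_le[of "{u, p, q}" "nb u"] by linarith
    also have "card P = 2"
      unfolding P_def using cubic[OF Wp] wp by simp
    also have "card Q = 2"
      unfolding Q_def using cubic[OF Wq] wq by simp
    also have "card {u, p, q} \<le> 3" by (simp add: card_insert_if)
    finally show ?thesis using nbu by simp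
  qed
  \<comment> \<open>The vertices of \<open>W\<close> are counted by their unique neighbor in \<open>nb v\<close>.\<close>
  have "3 * (card V - 8) = (\<Sum>u\<in>nb v. card V - 8)" using v by simp
  also have "\<dots> \<le> (\<Sum>u\<in>nb v. card (nb u \<inter> W))" using large by (intro sum_mono) fastforce
  also have "\<dots> = (\<Sum>w\<in>W. d w)"
    unfolding d_def using finW finite_nb by (intro cross_edges_symmetric) (auto simp: W_def)
  also have "\<dots> = card W" using df by simp
  finally show False using cV n by simp
qed

text \<open>For a vertex \<open>v\<close> of minimum degree \<open>d\<close>, each vertex not in \<open>{v} \<union> nb v\<close> sends two edges to \<open>nb v\<close>, which gives
  \<open>d + 2 (n - 1 - d) = 2n - 2 - d\<close> edges. For \<open>d = 2\<close> this is \<open>2n - 4\<close>, with equality only if every vertex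
  outside \<open>nb v\<close> is joined to both elements of \<open>nb v\<close> and there are no other edges. For \<open>d = 3\<close> the degree
  condition supplies more than one further edge, and for \<open>d \<ge> 4\<close> summing degrees is enough.\<close>

lemma two_common_neighbors_bound:
  assumes two: "\<And>u w. u \<in> V \<Longrightarrow> w \<in> V \<Longrightarrow> u \<noteq> w \<Longrightarrow> w \<notin> nb u \<Longrightarrow> 2 \<le> card (nb w \<inter> nb u)"
    and n: "9 \<le> card V"
  shows "2 * card V - 4 \<le> card E"
    and "card E = 2 * card V - 4 \<Longrightarrow>
      \<exists>D. D \<subseteq> V \<and> card D = 2 \<and> E = {{d, w} | d w. d \<in> D \<and> w \<in> V - D}"
proof -
  have "V \<noteq> {}" using n by auto
  then obtain v where v: "v \<in> V" and min: "\<And>w. w \<in> V \<Longrightarrow> card (nb v) \<le> card (nb w)"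
    using ex_is_arg_min_if_finite[OF finite_V, of "\<lambda>u. card (nb u)"]
    by (auto simp: is_arg_min_linorder)
  define W where "W = V - insert v (nb v)"
  define d where "d w = card (nb w \<inter> nb v)" for w
  have finW: "finite W" using finite_V by (simp add: W_def)
  have cV: "card V = card (nb v) + card W + 1"
    and cE: "card E = card (nb v) + edges_in (nb v) + edges_in W + (\<Sum>w\<in>W. d w)"
    using card_E_around[OF v] unfolding W_def d_def by simp_all
  have d2: "2 \<le> d w" if "w \<in> W" for w
    using two[of v w] v that by (auto simp: W_def d_def)
  have "(\<Sum>w\<in>W. 2) \<le> (\<Sum>w\<in>W. d w)" by (rule sum_mono) (rule d2)
  then have sd: "2 * card W \<le> (\<Sum>w\<in>W. d w)" by simp
  have ge2: "2 \<le> card (nb v)"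
  proof (rule ccontr)
    assume *: "\<not> 2 \<le> card (nb v)"
    then have "W \<noteq> {}" using cV n by auto
    then obtain w where "w \<in> W" by blast
    then have "2 \<le> d w" by (rule d2)
    also have "d w \<le> card (nb v)" unfolding d_def using finite_nb by (intro card_mono) auto
    finally show False using * by simp
  qed
  have big: "2 * card V - 4 < card E" if "card (nb v) \<noteq> 2"
  proof (cases "card (nb v) = 3")
    case True
    have f: "5 \<le> card (nb w \<inter> W) + 2 * d w" if "w \<in> W" for w
      using d2[OF that] min[of w] that degree_split[OF v, of w] True
      by (auto simp: W_def d_def)
    have "5 * card W = (\<Sum>w\<in>W. 5)" by simp
    also have "\<dots> \<le> (\<Sum>w\<in>W. card (nb w \<inter> W) + 2 * d w)" by (rule sum_mono) (rule f)
    also have "\<dots> = 2 * edges_in W + 2 * (\<Sum>w\<in>W. d w)"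
      using handshake[OF finW] by (simp add: sum.distrib sum_distrib_left)
    finally show ?thesis using cE cV True n by simp
  next
    case False
    then have "4 \<le> card (nb w)" if "w \<in> V" for w
      using ge2 \<open>card (nb v) \<noteq> 2\<close> min[OF that] by simp
    then show ?thesis using degree_ge_imp_card_E[of 4] n by simp
  qed
  show "2 * card V - 4 \<le> card E"
    using big cE cV sd by (cases "card (nb v) = 2") auto
  assume eq: "card E = 2 * card V - 4"
  then have D: "card (nb v) = 2" using big by fastforce
  have sd_eq: "(\<Sum>w\<in>W. d w) = (\<Sum>w\<in>W. 2)" using eq cE cV D sd by simp
  have "nb v \<subseteq> nb w" if "w \<in> W" for w
  proof -
    have "d w = 2" using sum_mono_inv[OF sd_eq[symmetric] _ that finW] d2 by simp
    then have "nb w \<inter> nb v = nb v"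
      using D finite_nb by (intro card_subset_eq) (auto simp: d_def)
    then show ?thesis by blast
  qed
  then have "x \<in> nb w" if "x \<in> nb v" "w \<in> V - nb v" for x w
    using that by (cases "w = v") (auto simp: W_def)
  then have "w \<in> nb x" if "x \<in> nb v" "w \<in> V - nb v" for x w
    using that nb_sym by blast
  then have "{x, w} \<in> E" if "x \<in> nb v" "w \<in> V - nb v" for x w
    using that unfolding nb_def by blast
  then have "{{x, w} | x w. x \<in> nb v \<and> w \<in> V - nb v} \<subseteq> E" (is "?B \<subseteq> E")
    by blast
  moreover have "card ?B = card E"
    using card_edges_between[of "nb v" "V - nb v"] finite_nb finite_V D eq cV nb_subset[of v]
    by (simp add: card_Diff_subset)
  ultimately have "?B = E" using finite_E by (intro card_subset_eq) auto
  then show "\<exists>D. D \<subseteq> V \<and> card D = 2 \<and> E = {{d, w} | d w. d \<in> D \<and> w \<in> V - D}"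
    using D nb_subset by (intro exI[of _ "nb v"]) simp
qed

end

section \<open>Two colors\<close>

text \<open>The two colors are the truth values of \<open>red\<close>. The assumption is what saturation says about a non-edge \<open>uw\<close>
  and a color \<open>a\<close>: if all paths of length two from \<open>u\<close> to \<open>w\<close> had both edges of color \<open>a\<close>, then adding
  \<open>uw\<close> in color \<open>a\<close> would create monochromatic triangles only.\<close>

locale two_colored = edge_set +
  fixes red :: "'a set \<Rightarrow> bool"
  assumes not_mono: "\<lbrakk>u \<in> V; w \<in> V; u \<noteq> w; w \<notin> nb u\<rbrakk> \<Longrightarrow>
    \<exists>z. z \<in> nb u \<and> z \<in> nb w \<and> (red {u, z} \<noteq> a \<or> red {w, z} \<noteq> a)"
begin

text \<open>The one configuration that a count of edges does not exclude, when \<open>v\<close> has degree two: \<open>c\<close> is adjacent to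
  \<open>y\<close> and to all private neighbors \<open>X\<close> of \<open>x\<close>, which have no further neighbors, and \<open>x\<close>, \<open>y\<close> are not
  adjacent. Non-adjacent pairs with few common neighbors determine nearly all colors, until the pair
  \<open>x\<close>, \<open>y\<close> has only monochromatic paths, all of the same color.\<close>

lemma no_spiked_star:
  assumes v: "nb v = {x, y}" "x \<noteq> y" "y \<notin> nb x"
    and X: "X = nb x - nb y" "X \<noteq> {}" "\<And>u. u \<in> X \<Longrightarrow> nb u = {x, c}"
    and c: "nb c = insert y X" "nb y - nb x = {c}"
  shows False
proof -
  define \<alpha> \<beta> where "\<alpha> = red {v, x}" and "\<beta> = red {v, y}"
  have vx: "v \<in> nb x" "v \<in> nb y" using v(1) nb_sym[of v] by auto
  have irr: "\<And>p. p \<notin> nb p" by (rule nb_irrefl)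
  have V: "v \<in> V" "x \<in> V" "y \<in> V" using vx nb_in_V by auto
  have cy: "c \<in> nb y" "c \<notin> nb x" using c by auto
  then have cV: "c \<in> V" using nb_in_V by blast
  have cn: "c \<noteq> v" "c \<noteq> x" "c \<noteq> y" using cy vx irr nb_sym v(3) by auto
  have Xn: "u \<in> V" "u \<in> nb x" "u \<notin> nb y" "u \<noteq> v" "u \<noteq> x" "u \<noteq> y" "y \<notin> nb u" if "u \<in> X" for u
    using that X(1) vx v(3) irr nb_sym[of u] nb_in_V[of u x] by auto
  \<comment> \<open>The pair \<open>v\<close>, \<open>u\<close> has only the path through \<open>x\<close>.\<close>
  have ux: "red {u, x} = (\<not> \<alpha>)" if u: "u \<in> X" for u
  proof -
    have "u \<notin> nb v" using Xn[OF u] v(1) by auto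
    then obtain z where "z \<in> nb v" "z \<in> nb u" "red {v, z} \<noteq> \<alpha> \<or> red {u, z} \<noteq> \<alpha>"
      using not_mono[of v u \<alpha>] V Xn[OF u] by auto
    then show ?thesis using v(1) Xn[OF u] by (auto simp: \<alpha>_def)
  qed
  have "c \<notin> nb v" using cn v(1) by auto
  then obtain z where "z \<in> nb v" "z \<in> nb c" "red {v, z} \<noteq> \<beta> \<or> red {c, z} \<noteq> \<beta>"
    using not_mono[of v c \<beta>] V cV cn by auto
  then have cyb: "red {c, y} = (\<not> \<beta>)"
    using v(1) cy nb_sym[of x c] by (auto simp: \<beta>_def)
  \<comment> \<open>The pair \<open>u\<close>, \<open>y\<close> has only the path through \<open>c\<close>.\<close>
  have uc: "red {u, c} = \<beta>" if u: "u \<in> X" for u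
  proof -
    obtain z where "z \<in> nb u" "z \<in> nb y" "red {u, z} \<noteq> (\<not> \<beta>) \<or> red {y, z} \<noteq> (\<not> \<beta>)"
      using not_mono[of u y "\<not> \<beta>"] V Xn[OF u] by auto
    then show ?thesis using X(3)[OF u] cyb v(3) nb_sym[of x y] by (auto simp: insert_commute)
  qed
  \<comment> \<open>The paths from \<open>c\<close> to \<open>x\<close> all run through \<open>X\<close>, with colors \<open>\<beta>\<close> and then not \<open>\<alpha>\<close>; as they are not all
    monochromatic of color \<open>\<beta>\<close>, the two colors agree.\<close>
  have "x \<notin> nb c" using cy nb_sym by blast
  then obtain u where u: "u \<in> nb c" "u \<in> nb x" "red {c, u} \<noteq> \<beta> \<or> red {x, u} \<noteq> \<beta>"
    using not_mono[of c x \<beta>] V cV cn by auto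
  then have uX: "u \<in> X" using c(1) v(3) by auto
  then have ab: "\<alpha> = \<beta>" using u(3) uc[OF uX] ux[OF uX] by (auto simp: insert_commute)
  \<comment> \<open>A common neighbor \<open>z\<close> of \<open>x\<close> and \<open>y\<close> that is not joined to both in color \<open>\<alpha>\<close>; the pairs \<open>u\<close>, \<open>z\<close> and
    \<open>c\<close>, \<open>z\<close> nevertheless force both of these edges to have color \<open>\<alpha>\<close>.\<close>
  obtain z where z: "z \<in> nb x" "z \<in> nb y" "red {x, z} \<noteq> \<alpha> \<or> red {y, z} \<noteq> \<alpha>"
    using not_mono[of x y \<alpha>] V v by auto
  have zn: "z \<in> V" "z \<noteq> v" "z \<noteq> x" "z \<noteq> y" "z \<noteq> c" "z \<noteq> u" "z \<notin> X"
    using z nb_in_V[of z x] irr cy(2) Xn[OF uX] ab X(1) by (auto simp: \<alpha>_def \<beta>_def insert_commute)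
  have "z \<notin> nb u" using X(3)[OF uX] zn by auto
  then obtain s where "s \<in> nb u" "s \<in> nb z" "red {u, s} \<noteq> (\<not> \<alpha>) \<or> red {z, s} \<noteq> (\<not> \<alpha>)"
    using not_mono[of u z "\<not> \<alpha>"] Xn[OF uX] zn by auto
  then have zx: "red {z, x} = \<alpha>"
    using X(3)[OF uX] c(1) nb_sym[of c z] zn ux[OF uX] by auto
  have "z \<notin> nb c" using c(1) zn by auto
  then obtain s where s: "s \<in> nb c" "s \<in> nb z" "red {c, s} \<noteq> (\<not> \<alpha>) \<or> red {z, s} \<noteq> (\<not> \<alpha>)"
    using not_mono[of c z "\<not> \<alpha>"] cV zn by auto
  have "s \<notin> X" using s(2) X(3)[of s] nb_sym[of s z] zn by auto
  then have "red {z, y} = \<alpha>" using s c(1) cyb ab by auto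
  then show False using z(3) zx by (simp add: insert_commute)
qed

text \<open>Suppose that the vertices adjacent to exactly one of \<open>x\<close> and \<open>y\<close> form a component of \<open>W\<close> with too few
  edges to contain a cycle. Any two of them are at distance at most two within \<open>S\<close>, so a vertex \<open>l\<close> of degree
  one in \<open>S\<close> makes its neighbor \<open>c\<close> adjacent to all of \<open>S\<close>, and the edge count makes \<open>S\<close> a star. Each
  vertex of \<open>S\<close> attached to \<open>x\<close> needs a neighbor in \<open>S\<close> attached to \<open>y\<close> and vice versa, which leaves only the
  star excluded by \<open>no_spiked_star\<close>.\<close>

lemma no_tree_component:
  assumes v: "nb v = {x, y}" "x \<noteq> y" "y \<notin> nb x"
  defines "S \<equiv> (nb x - nb y) \<union> (nb y - nb x)"
  assumes closed: "\<And>p. p \<in> S \<Longrightarrow> nb p \<subseteq> S \<union> {x, y}"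
    and linked: "\<And>p q. p \<in> S \<Longrightarrow> q \<in> S \<Longrightarrow> p \<noteq> q \<Longrightarrow> q \<notin> nb p \<Longrightarrow> nb p \<inter> nb q \<inter> S \<noteq> {}"
    and tree: "edges_in S + 1 \<le> card S"
    and leaf: "l \<in> S" "l \<in> nb x" "card (nb l \<inter> S) \<le> 1"
  shows False
proof -
  have finS: "finite S" using finite_nb by (simp add: S_def)
  have irr: "\<And>p. p \<notin> nb p" by (rule nb_irrefl)
  have V: "x \<in> V" "y \<in> V" using v(1) nb_in_V[of _ v] by auto
  have xy: "x \<notin> S" "y \<notin> S" using v(3) nb_sym[of x y] irr by (auto simp: S_def)
  have SV: "p \<in> V" if "p \<in> S" for p using that nb_in_V by (auto simp: S_def)
  have to_y: "\<exists>z\<in>nb p \<inter> S. z \<in> nb y" if p: "p \<in> S" "p \<in> nb x" for p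
  proof -
    have "p \<notin> nb y" using p by (auto simp: S_def)
    then obtain z where z: "z \<in> nb p" "z \<in> nb y"
      using not_mono[of p y] p SV[OF p(1)] V xy nb_sym[of y p] by auto
    then show ?thesis using closed[OF p(1)] v(3) irr nb_sym[of x y] by auto
  qed
  have to_x: "\<exists>z\<in>nb p \<inter> S. z \<in> nb x" if p: "p \<in> S" "p \<in> nb y" for p
  proof -
    have "p \<notin> nb x" using p by (auto simp: S_def)
    then obtain z where z: "z \<in> nb p" "z \<in> nb x"
      using not_mono[of p x] p SV[OF p(1)] V xy nb_sym[of x p] by auto
    then show ?thesis using closed[OF p(1)] v(3) irr nb_sym[of x y] by auto
  qed
  obtain c where c: "c \<in> nb l" "c \<in> S" "c \<in> nb y" using to_y leaf by blast
  then have "card (nb l \<inter> S) = 1"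
    using leaf(3) finite_nb card_gt_0_iff[of "nb l \<inter> S"] by fastforce
  then have lc: "nb l \<inter> S = {c}" using c by (metis IntI card_1_singletonE singletonD)
  have cx: "c \<notin> nb x" using c by (auto simp: S_def)
  have cl: "c \<noteq> l" using c(1) irr by auto
  have centre: "S - {c} \<subseteq> nb c"
  proof
    fix q assume q: "q \<in> S - {c}"
    show "q \<in> nb c"
    proof (cases "q = l")
      case True
      then show ?thesis using c nb_sym by blast
    next
      case False
      have "q \<notin> nb l" using lc q by auto
      then have "nb l \<inter> nb q \<inter> S \<noteq> {}" using linked[of l q] leaf(1) q False by blast
      then have "c \<in> nb q" unfolding Int_assoc Int_left_commute[of _ "nb q"] lc by blast
      then show ?thesis using nb_sym by blast
    qed
  qed
  have "edges_in S = edges_in (S - {c}) + card (nb c \<inter> (S - {c}))"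
    using edges_in_insert[of c "S - {c}"] c(2) by (simp add: insert_absorb)
  also have "nb c \<inter> (S - {c}) = S - {c}" using centre by blast
  finally have "edges_in (S - {c}) = 0" using tree c(2) finS by (simp add: card_gt_0_iff)
  then have "(\<Sum>w\<in>S - {c}. card (nb w \<inter> (S - {c}))) = 0"
    using handshake[of "S - {c}"] finS by simp
  then have "card (nb q \<inter> (S - {c})) = 0" if "q \<in> S - {c}" for q
    using that finS by simp
  then have nbq: "nb q \<inter> S \<subseteq> {c}" if "q \<in> S - {c}" for q
    using that finS finite_nb[of q] by fastforce
  have leaves: "S - {c} = nb x - nb y"
  proof
    show "nb x - nb y \<subseteq> S - {c}" using cx by (auto simp: S_def)
    show "S - {c} \<subseteq> nb x - nb y"
    proof
      fix q assume q: "q \<in> S - {c}"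
      have "q \<notin> nb y" using to_x[of q] nbq[OF q] q cx by blast
      then show "q \<in> nb x - nb y" using q by (auto simp: S_def)
    qed
  qed
  have "nb u = {x, c}" if u: "u \<in> nb x - nb y" for u
  proof -
    have uS: "u \<in> S - {c}" using u leaves by simp
    have "u \<in> nb c" using centre uS by blast
    then show ?thesis
      using closed[of u] nbq[OF uS] uS u nb_sym[of u x] nb_sym[of u y] nb_sym[of u c] by auto
  qed
  moreover have "nb c = insert y (nb x - nb y)"
    using closed[OF c(2)] centre leaves irr[of c] c(3) cx nb_sym[of c x] nb_sym[of c y] by auto
  moreover have "nb y - nb x = {c}" using leaves c cx by (auto simp: S_def)
  moreover have "nb x - nb y \<noteq> {}" using leaves leaf(1) cl by blast
  ultimately show False by (intro no_spiked_star[OF v refl])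
qed

text \<open>If \<open>u\<close> is the only neighbor of \<open>v\<close>, then \<open>u\<close> is joined to every other vertex in the color different from
  that of \<open>uv\<close>. Non-adjacent vertices of \<open>W\<close> therefore need a common neighbor other than \<open>u\<close>, so \<open>W\<close> is
  connected and has at least \<open>|W| - 1 = n - 3\<close> edges, besides the \<open>n - 1\<close> edges at \<open>u\<close>.\<close>

lemma degree_one_bound:
  assumes "v \<in> V" "card (nb v) = 1"
  shows "2 * card V - 4 \<le> card E"
proof -
  obtain u where u: "nb v = {u}" using assms by (auto simp: card_1_singleton_iff)
  define W where "W = V - insert v (nb v)"
  have cV: "card V = card W + 2" and cE: "card E = 1 + edges_in (nb v) + edges_in W + (\<Sum>w\<in>W. card (nb w \<inter> nb v))"
    using card_E_around[OF assms(1)] assms(2) unfolding W_def by simp_all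
  have Wu: "red {w, u} \<noteq> red {v, u}" "w \<in> V" "nb w \<inter> nb v = {u}" "v \<notin> nb w" if "w \<in> W" for w
  proof -
    have w: "w \<in> V" "w \<noteq> v" "w \<notin> nb v" using that by (auto simp: W_def)
    then obtain z where "z \<in> nb v" "z \<in> nb w" "red {v, z} \<noteq> red {v, u} \<or> red {w, z} \<noteq> red {v, u}"
      using not_mono[of v w "red {v, u}"] assms(1) by auto
    then show "red {w, u} \<noteq> red {v, u}" "w \<in> V" "nb w \<inter> nb v = {u}" "v \<notin> nb w"
      using u w nb_sym[of v w] by auto
  qed
  have W: "card W \<le> edges_in W + 1"
  proof (cases "W = {}")
    case False
    have linked: "nb p \<inter> nb q \<inter> W \<noteq> {}" if pq: "p \<in> W" "q \<in> W" "p \<noteq> q" "q \<notin> nb p" for p q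
    proof -
      obtain z where z: "z \<in> nb p" "z \<in> nb q" "red {p, z} \<noteq> (\<not> red {v, u}) \<or> red {q, z} \<noteq> (\<not> red {v, u})"
        using not_mono[of p q "\<not> red {v, u}"] Wu(2) pq by blast
      have "z \<noteq> u" using z(3) Wu(1)[OF pq(1)] Wu(1)[OF pq(2)] by auto
      moreover have "z \<noteq> v" using z(1) Wu(4)[OF pq(1)] by auto
      ultimately have "z \<in> W" using z(1) nb_subset u by (auto simp: W_def)
      then show ?thesis using z by blast
    qed
    obtain A where A: "W \<subseteq> A" "A \<subseteq> W" "card A \<le> edges_in A + 1"
      by (rule linked_component[of W W]) (use linked False in \<open>auto simp: W_def\<close>)
    then have "A = W" by blast
    then show ?thesis using A by simp
  qed simp
  have "(\<Sum>w\<in>W. card (nb w \<inter> nb v)) = card W" using Wu(3) by simp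
  then show ?thesis using cE cV W by simp
qed

text \<open>Let \<open>S\<close> consist of the vertices of \<open>W\<close> with just one neighbor among \<open>x\<close> and \<open>y\<close>; the others form \<open>Z\<close>. The
  bound amounts to finding \<open>|S|\<close> edges inside \<open>W\<close> or between \<open>x\<close> and \<open>y\<close>. The edge from a vertex of \<open>S\<close> to its
  neighbor \<open>d\<close> among \<open>x\<close>, \<open>y\<close> does not have the color of \<open>vd\<close>, so two non-adjacent vertices of \<open>S\<close> always have a common
  neighbor in \<open>W\<close>. Thus \<open>S\<close> lies in one component \<open>A\<close> of \<open>W\<close>, which gives \<open>|A| - 1\<close> edges. This suffices
  unless \<open>A = S\<close>, the component is a tree, and \<open>x\<close>, \<open>y\<close> are not adjacent; that case is
  \<open>no_tree_component\<close>.\<close>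

lemma degree_two_bound:
  assumes "v \<in> V" "card (nb v) = 2"
  shows "2 * card V - 4 \<le> card E"
proof (rule ccontr)
  assume less: "\<not> 2 * card V - 4 \<le> card E"
  obtain x y where xy: "nb v = {x, y}" "x \<noteq> y" using assms by (auto simp: card_2_iff)
  define W where "W = V - insert v (nb v)"
  define Z where "Z = W \<inter> nb x \<inter> nb y"
  define S where "S = W - Z"
  have finW: "finite W" using finite_V by (simp add: W_def)
  have cV: "card V = card W + 3" and cE: "card E = 2 + edges_in (nb v) + edges_in W + (\<Sum>w\<in>W. card (nb w \<inter> nb v))"
    using card_E_around[OF assms(1)] assms(2) unfolding W_def by simp_all
  have WV: "w \<in> V" "w \<noteq> v" "w \<notin> nb v" "v \<notin> nb w" if "w \<in> W" for w
    using that nb_sym[of v w] by (auto simp: W_def)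
  have nbW: "nb w \<inter> nb v = (if w \<in> Z then {x, y} else if w \<in> nb x then {x} else {y})" "w \<in> nb x \<or> w \<in> nb y"
    if w: "w \<in> W" for w
  proof -
    obtain z where "z \<in> nb v" "z \<in> nb w" using not_mono[of v w] WV[OF w] assms(1) by blast
    then have *: "x \<in> nb w \<or> y \<in> nb w" using xy by auto
    then show "w \<in> nb x \<or> w \<in> nb y" using nb_sym by blast
    show "nb w \<inter> nb v = (if w \<in> Z then {x, y} else if w \<in> nb x then {x} else {y})"
      using * w xy nb_sym[of x w] nb_sym[of y w] by (auto simp: Z_def)
  qed
  have "(\<Sum>w\<in>W. card (nb w \<inter> nb v)) = (\<Sum>w\<in>W. 1 + (if w \<in> Z then 1 else 0))"
    using nbW(1) xy(2) by (intro sum.cong) simp_all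
  also have "\<dots> = card W + card Z"
  proof -
    have "W \<inter> Z = Z" by (auto simp: Z_def)
    then show ?thesis using finW by (simp only: sum.distrib sum.If_cases Collect_mem_eq) simp
  qed
  finally have sum_eq: "(\<Sum>w\<in>W. card (nb w \<inter> nb v)) = card W + card Z" .
  have small: "edges_in (nb v) + edges_in W < card S"
  proof -
    have "Z \<subseteq> W" by (auto simp: Z_def)
    then have "card S + card Z = card W"
      unfolding S_def using finW card_mono[of W Z] finite_subset[of Z W] by (simp add: card_Diff_subset)
    then show ?thesis using less cV cE sum_eq by linarith
  qed
  have single: "nb p \<inter> nb v = {d}" if p: "p \<in> S" and d: "d \<in> nb v" "d \<in> nb p" for p d
  proof -
    have "p \<in> W" "p \<notin> Z" using p by (auto simp: S_def)
    then obtain e where "nb p \<inter> nb v = {e}" using nbW(1)[of p] by (auto split: if_splits)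
    moreover have "d \<in> nb p \<inter> nb v" using d by blast
    ultimately show ?thesis by auto
  qed
  have col: "red {p, d} \<noteq> red {v, d}" if p: "p \<in> S" and d: "d \<in> nb v" "d \<in> nb p" for p d
  proof -
    have pW: "p \<in> W" "p \<notin> Z" using p by (auto simp: S_def)
    obtain z where z: "z \<in> nb v" "z \<in> nb p" "red {v, z} \<noteq> red {v, d} \<or> red {p, z} \<noteq> red {v, d}"
      using not_mono[of v p "red {v, d}"] WV[OF pW(1)] assms(1) by auto
    moreover have "z = d"
      using z(1,2) single[OF p d] by blast
    ultimately show ?thesis by auto
  qed
  have linked: "nb p \<inter> nb q \<inter> W \<noteq> {}" if pq: "p \<in> S" "q \<in> S" "p \<noteq> q" "q \<notin> nb p" for p q
  proof -
    have W: "p \<in> W" "q \<in> W" using pq by (auto simp: S_def)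
    have "\<exists>z. z \<in> nb p \<and> z \<in> nb q \<and> z \<notin> nb v"
    proof (cases "\<exists>d. d \<in> nb v \<and> d \<in> nb p \<and> d \<in> nb q")
      case True
      then obtain d where d: "d \<in> nb v" "d \<in> nb p" "d \<in> nb q" by blast
      obtain z where z: "z \<in> nb p" "z \<in> nb q" "red {p, z} \<noteq> (\<not> red {v, d}) \<or> red {q, z} \<noteq> (\<not> red {v, d})"
        using not_mono[of p q "\<not> red {v, d}"] WV(1)[OF W(1)] WV(1)[OF W(2)] pq by blast
      have "z \<noteq> d" using z(3) col[OF pq(1) d(1,2)] col[OF pq(2) d(1,3)] by auto
      moreover have "nb p \<inter> nb v \<subseteq> {d}"
        using single[OF pq(1) d(1,2)] by blast
      ultimately show ?thesis using z by blast
    next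
      case False
      then show ?thesis
        using not_mono[of p q] WV(1)[OF W(1)] WV(1)[OF W(2)] pq by blast
    qed
    then obtain z where z: "z \<in> nb p" "z \<in> nb q" "z \<notin> nb v" by blast
    then have "z \<in> W" using WV(4)[OF W(1)] nb_subset by (auto simp: W_def)
    then show ?thesis using z by blast
  qed
  have "S \<noteq> {}" using small by auto
  then obtain A where A: "S \<subseteq> A" "A \<subseteq> W" "card A \<le> edges_in A + 1" "\<And>a. a \<in> A \<Longrightarrow> nb a \<inter> W \<subseteq> A"
    by (rule_tac linked_component[of S W]) (use linked in \<open>auto simp: S_def W_def\<close>)
  have finA: "finite A" using A(2) finW finite_subset by blast
  have "card S \<le> card A" by (rule card_mono[OF finA A(1)])
  moreover have "edges_in A \<le> edges_in W" by (rule edges_in_mono[OF A(2)])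
  ultimately have D0: "edges_in (nb v) = 0" and cA: "card A = card S" and eA: "edges_in A + 1 \<le> card A"
    using small A(3) by linarith+
  have AS: "A = S" using card_subset_eq[OF finA A(1)] cA by simp
  have nxy: "y \<notin> nb x"
  proof
    assume "y \<in> nb x"
    then have "{x, y} \<in> {e \<in> E. e \<subseteq> nb v}" using xy by (auto simp: nb_def)
    then show False using D0 finite_E by (auto simp: edges_in_def)
  qed
  have S: "S = (nb x - nb y) \<union> (nb y - nb x)"
    using nbW(2) nb_subset nxy nb_sym[of x y] nb_irrefl xy(1) nb_sym[of v x] nb_sym[of v y]
    by (auto simp: S_def Z_def W_def)
  have closed: "nb p \<subseteq> S \<union> {x, y}" if p: "p \<in> S" for p
  proof
    fix z assume z: "z \<in> nb p"
    have pW: "p \<in> W" using p by (simp add: S_def)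
    show "z \<in> S \<union> {x, y}"
      using z A(4)[of p] AS p nb_subset[of p] WV(4)[OF pW] xy(1) by (auto simp: W_def)
  qed
  \<comment> \<open>If all degrees within \<open>S\<close> were at least two, \<open>S\<close> would span \<open>|S|\<close> edges.\<close>
  have "\<exists>l\<in>S. card (nb l \<inter> S) \<le> 1"
  proof (rule ccontr)
    assume "\<not> (\<exists>l\<in>S. card (nb l \<inter> S) \<le> 1)"
    then have "(\<Sum>w\<in>S. 2) \<le> (\<Sum>w\<in>S. card (nb w \<inter> S))" by (intro sum_mono) auto
    then show False using handshake[of S] finA AS eA by simp
  qed
  then obtain l where l: "l \<in> S" "card (nb l \<inter> S) \<le> 1" by blast
  have link: "nb p \<inter> nb q \<inter> S \<noteq> {}" if pq: "p \<in> S" "q \<in> S" "p \<noteq> q" "q \<notin> nb p" for p q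
    using linked[OF pq] A(4)[of p] AS pq(1) by blast
  show False
  proof (cases "l \<in> nb x")
    case True
    show False
      by (rule no_tree_component[of v x y l])
        (use xy nxy closed link eA AS S l True in auto)
  next
    case False
    then have "l \<in> nb y" using l S by auto
    moreover have "S = (nb y - nb x) \<union> (nb x - nb y)" using S by blast
    moreover have "x \<notin> nb y" using nxy nb_sym by blast
    ultimately show False
      by (intro no_tree_component[of v y x l])
        (use xy closed link eA AS l in auto)
  qed
qed

lemma two_colored_edge_bound:
  assumes n: "11 \<le> card V"
  shows "2 * card V - 4 \<le> card E"
proof -
  have "V \<noteq> {}" using n by auto
  then obtain v where v: "v \<in> V" and min: "\<And>w. w \<in> V \<Longrightarrow> card (nb v) \<le> card (nb w)"
    using ex_is_arg_min_if_finite[OF finite_V, of "\<lambda>u. card (nb u)"]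
    by (auto simp: is_arg_min_linorder)
  have diam: "nb u \<inter> nb w \<noteq> {}" if "u \<in> V" "w \<in> V" "u \<noteq> w" "w \<notin> nb u" for u w
    using not_mono[OF that] by blast
  have "card (nb v) \<noteq> 0"
  proof
    assume "card (nb v) = 0"
    then have "nb v = {}" using finite_nb by simp
    then have "V = {v}" using diam[OF v] v by auto
    then show False using n card_1_singleton_iff[of V] by auto
  qed
  then consider "card (nb v) = 1" | "card (nb v) = 2" | "card (nb v) = 3" | "4 \<le> card (nb v)"
    by linarith
  then show ?thesis
  proof cases
    case 3
    then show ?thesis using diam v min n by (intro degree_three_bound[of v]) simp_all
  next
    case 4
    then have "4 * card V \<le> 2 * card E"
      using min by (intro degree_ge_imp_card_E) (meson le_trans)
    then show ?thesis by simp
  qed (use degree_one_bound degree_two_bound v in auto)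
qed

end

section \<open>Saturation in terms of common neighbors\<close>

definition bichromatic_triangle :: "'a colored_graph \<Rightarrow> 'a \<Rightarrow> 'a \<Rightarrow> 'a \<Rightarrow> bool" where
  "bichromatic_triangle G a b c \<longleftrightarrow>
     {a, b} \<in> edges G \<and> {b, c} \<in> edges G \<and> {a, c} \<in> edges G \<and>
     card {color G {a, b}, color G {b, c}, color G {a, c}} = 2"

lemma edges_complete_graph_3: "edges (complete_graph 3) = {{0, 1}, {1, 2}, {0, 2}}"
proof -
  have V: "{..<3::nat} = {0, 1, 2}" by auto
  have "{e. e \<subseteq> {0, 1, 2 :: nat} \<and> card e = 2} = {{0, 1}, {1, 2}, {0, 2}}" (is "?L = ?R")
  proof
    show "?L \<subseteq> ?R"
    proof
      fix e assume e: "e \<in> ?L"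
      then obtain x y where xy: "e = {x, y}" "x \<noteq> y" by (auto simp: card_2_iff)
      then have "x = 0 \<or> x = 1 \<or> x = 2" "y = 0 \<or> y = 1 \<or> y = 2" using e by auto
      then show "e \<in> ?R" using xy by (elim disjE) (simp_all add: doubleton_eq_iff)
    qed
  qed auto
  then show ?thesis by (simp add: complete_graph_def V)
qed

text \<open>Translates copies of members of the family into three explicit vertices. Distinctness of the vertices
  comes for free, since edges have two elements.\<close>

lemma contains_two_colored_triangle_iff:
  assumes "edge_colored t G"
  shows "(\<exists>H\<in>colorings_using t 2 (complete_graph 3). colored_subgraph H G) \<longleftrightarrow>
    (\<exists>a b c. bichromatic_triangle G a b c)" (is "?L \<longleftrightarrow> ?R")
proof
  assume ?L
  then obtain c f where c: "card (c ` edges (complete_graph 3)) = 2"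
    and f: "\<forall>e\<in>edges (complete_graph 3). f ` e \<in> edges G \<and> color G (f ` e) = c e"
    by (auto simp: colorings_using_def colored_subgraph_def)
  then have "bichromatic_triangle G (f 0) (f 1) (f 2)"
    by (simp add: bichromatic_triangle_def edges_complete_graph_3)
  then show ?R by blast
next
  assume ?R
  then obtain a b c where tri: "bichromatic_triangle G a b c" by blast
  have V3: "verts (complete_graph 3) = {0, 1, 2}" by (auto simp: complete_graph_def)
  define f where "f i = (if i = 0 then a else if i = 1 then b else c)" for i :: nat
  define k where "k e = color G (f ` e)" for e
  let ?H = "\<lparr>verts = verts (complete_graph 3), edges = edges (complete_graph 3), color = k\<rparr>"
  have simple: "\<forall>e\<in>edges G. e \<subseteq> verts G \<and> card e = 2"
    and range: "\<forall>e\<in>edges G. color G e \<in> {1..t}"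
    using assms by (auto simp: edge_colored_def simple_graph_def)
  have e: "{a, b} \<in> edges G" "{b, c} \<in> edges G" "{a, c} \<in> edges G"
    using tri by (auto simp: bichromatic_triangle_def)
  then have d: "a \<noteq> b" "b \<noteq> c" "a \<noteq> c" and inV: "a \<in> verts G" "b \<in> verts G" "c \<in> verts G"
    using simple by fastforce+
  have k: "k {0, 1} = color G {a, b}" "k {1, 2} = color G {b, c}" "k {0, 2} = color G {a, c}"
    by (simp_all add: k_def f_def insert_commute)
  have "?H \<in> colorings_using t 2 (complete_graph 3)"
    using tri e range k
    by (simp add: colorings_using_def edges_complete_graph_3 bichromatic_triangle_def)
  moreover have "colored_subgraph ?H G"
    unfolding colored_subgraph_def
    by (rule exI[of _ f])
      (use d inV e in \<open>auto simp: edges_complete_graph_3 V3 k_def f_def inj_on_def insert_commute[of _ a] insert_commute[of c b]\<close>)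
  ultimately show ?L by blast
qed

text \<open>Adding the non-edge \<open>uw\<close> can only create triangles \<open>u w z\<close> through the new edge, so the saturation condition
  concerns the colors at common neighbors \<open>z\<close> alone.\<close>

lemma saturated_iff:
  "saturated (colorings_using t 2 (complete_graph 3)) t G \<longleftrightarrow>
     edge_colored t G \<and> (\<forall>a b c. \<not> bichromatic_triangle G a b c) \<and>
     (\<forall>u\<in>verts G. \<forall>w\<in>verts G. u \<noteq> w \<and> {u, w} \<notin> edges G \<longrightarrow>
       (\<forall>i\<in>{1..t}. \<exists>z. {u, z} \<in> edges G \<and> {w, z} \<in> edges G \<and>
         card {i, color G {u, z}, color G {w, z}} = 2))"
proof -
  have add: "(\<exists>H\<in>colorings_using t 2 (complete_graph 3). colored_subgraph H (add_edge {u, w} i G)) \<longleftrightarrow>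
      (\<exists>z. {u, z} \<in> edges G \<and> {w, z} \<in> edges G \<and> card {i, color G {u, z}, color G {w, z}} = 2)"
    if G: "edge_colored t G" "\<forall>a b c. \<not> bichromatic_triangle G a b c"
      and uw: "u \<in> verts G" "w \<in> verts G" "u \<noteq> w" "{u, w} \<notin> edges G" and i: "i \<in> {1..t}"
    for u w i
  proof -
    let ?A = "add_edge {u, w} i G"
    have A: "edges ?A = insert {u, w} (edges G)" "color ?A = (color G)({u, w} := i)"
      by (simp_all add: add_edge_def)
    have "edge_colored t ?A"
      using G(1) uw i by (auto simp: edge_colored_def simple_graph_def add_edge_def)
    note contains_two_colored_triangle_iff[OF this]
    moreover have "(\<exists>a b c. bichromatic_triangle ?A a b c) \<longleftrightarrow>
      (\<exists>z. {u, z} \<in> edges G \<and> {w, z} \<in> edges G \<and> card {i, color G {u, z}, color G {w, z}} = 2)"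
      (is "?L \<longleftrightarrow> ?R")
    proof
      assume ?R
      then obtain z where z: "{u, z} \<in> edges G" "{w, z} \<in> edges G"
        "card {i, color G {u, z}, color G {w, z}} = 2" by blast
      then have "{u, z} \<noteq> {u, w}" "{w, z} \<noteq> {u, w}" using uw by auto
      then have "bichromatic_triangle ?A u w z"
        using z unfolding bichromatic_triangle_def A by (simp add: insert_commute)
      then show ?L by blast
    next
      assume ?L
      then obtain a b c where tri: "bichromatic_triangle ?A a b c" by blast
      have loops: "{p} \<notin> edges ?A" for p
        using \<open>edge_colored t ?A\<close> by (force simp: edge_colored_def simple_graph_def)
      have key: ?R if "{p, q} = {u, w}" "bichromatic_triangle ?A p q r" for p q r
      proof -
        have "p \<noteq> r" "q \<noteq> r" using that(2) loops[of r] by (auto simp: bichromatic_triangle_def)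
        then have "{p, r} \<noteq> {u, w}" "{q, r} \<noteq> {u, w}"
          using that(1) by (auto simp: doubleton_eq_iff)
        then have "{p, r} \<in> edges G" "{q, r} \<in> edges G"
          "card {i, color G {q, r}, color G {p, r}} = 2"
          using that unfolding bichromatic_triangle_def A by auto
        then show ?R using that(1) by (auto simp: doubleton_eq_iff insert_commute)
      qed
      have rot: "bichromatic_triangle ?A b c a" "bichromatic_triangle ?A a c b"
        using tri by (simp_all add: bichromatic_triangle_def insert_commute)
      have "bichromatic_triangle G a b c"
        if "{a, b} \<noteq> {u, w}" "{b, c} \<noteq> {u, w}" "{a, c} \<noteq> {u, w}"
        using tri that unfolding bichromatic_triangle_def A by simp
      then consider "{a, b} = {u, w}" | "{b, c} = {u, w}" | "{a, c} = {u, w}" | "bichromatic_triangle G a b c"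
        by blast
      then show ?R using key tri rot G(2) by cases blast+
    qed
    ultimately show ?thesis by simp
  qed
  show ?thesis
  proof (cases "edge_colored t G \<and> (\<forall>a b c. \<not> bichromatic_triangle G a b c)")
    case False
    then show ?thesis using contains_two_colored_triangle_iff[of t G] by (auto simp: saturated_def)
  next
    case True
    have "(\<forall>e\<in>non_edges G. P e) \<longleftrightarrow>
        (\<forall>u\<in>verts G. \<forall>w\<in>verts G. u \<noteq> w \<and> {u, w} \<notin> edges G \<longrightarrow> P {u, w})" for P
    proof (intro iffI ballI impI)
      fix u w
      assume "\<forall>e\<in>non_edges G. P e" "u \<in> verts G" "w \<in> verts G" "u \<noteq> w \<and> {u, w} \<notin> edges G"
      then show "P {u, w}" by (elim ballE[of _ _ "{u, w}"]) (auto simp: non_edges_def)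
    next
      fix e
      assume P: "\<forall>u\<in>verts G. \<forall>w\<in>verts G. u \<noteq> w \<and> {u, w} \<notin> edges G \<longrightarrow> P {u, w}"
        and e: "e \<in> non_edges G"
      then obtain u w where "e = {u, w}" "u \<noteq> w" by (auto simp: non_edges_def card_2_iff)
      then show "P e" using P e by (auto simp: non_edges_def)
    qed
    then show ?thesis
      using True contains_two_colored_triangle_iff[of t G] add by (simp add: saturated_def)
  qed
qed

lemma edge_set_of_edge_colored:
  "edge_colored t G \<Longrightarrow> edge_set (verts G) (edges G)"
  by (unfold_locales) (auto simp: edge_colored_def simple_graph_def)

lemma card_three_eq_2: "card {i, p, q} = 2 \<longleftrightarrow> \<not> (p = i \<and> q = i) \<and> (p = q \<or> p = i \<or> q = i)"
  by (auto simp: card_insert_if)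

lemma saturated_two_colors_lower_bound:
  assumes sat: "saturated (colorings_using 2 2 (complete_graph 3)) 2 G" and n: "11 \<le> card (verts G)"
  shows "2 * card (verts G) - 4 \<le> card (edges G)"
proof -
  have G: "edge_colored 2 G" using sat by (simp add: saturated_iff)
  interpret edge_set "verts G" "edges G" by (rule edge_set_of_edge_colored[OF G])
  interpret two_colored "verts G" "edges G" "\<lambda>e. color G e = 1"
  proof
    fix u w a
    assume "u \<in> verts G" "w \<in> verts G" "u \<noteq> w" "w \<notin> nb u"
    moreover define i :: nat where "i = (if a then 1 else 2)"
    then have "i \<in> {1..2}" by simp
    ultimately obtain z where z: "{u, z} \<in> edges G" "{w, z} \<in> edges G"
      "card {i, color G {u, z}, color G {w, z}} = 2"
      using sat unfolding saturated_iff nb_def by blast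
    then have "color G {u, z} \<in> {1..2}" "color G {w, z} \<in> {1..2}"
      using G by (auto simp: edge_colored_def)
    then show "\<exists>z. z \<in> nb u \<and> z \<in> nb w \<and>
        ((color G {u, z} = 1) \<noteq> a \<or> (color G {w, z} = 1) \<noteq> a)"
      using z by (intro exI[of _ z]) (auto simp: nb_def i_def card_three_eq_2 split: if_splits)
  qed
  show ?thesis by (rule two_colored_edge_bound[OF n])
qed

text \<open>A single common neighbor \<open>z\<close> of \<open>u\<close> and \<open>w\<close> never suffices with three colors. If \<open>uz\<close> and \<open>wz\<close> have the
  same color, adding \<open>uw\<close> in that color gives a monochromatic triangle; otherwise a third color gives a
  rainbow one. So non-adjacent vertices have two common neighbors.\<close>

lemma saturated_three_colors:
  assumes sat: "saturated (colorings_using t 2 (complete_graph 3)) t G"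
    and t: "3 \<le> t" and n: "9 \<le> card (verts G)"
  shows "2 * card (verts G) - 4 \<le> card (edges G)"
    and "card (edges G) = 2 * card (verts G) - 4 \<Longrightarrow>
      \<exists>D. D \<subseteq> verts G \<and> card D = 2 \<and> edges G = {{d, w} | d w. d \<in> D \<and> w \<in> verts G - D}"
proof -
  have G: "edge_colored t G" using sat by (simp add: saturated_iff)
  interpret edge_set "verts G" "edges G" by (rule edge_set_of_edge_colored[OF G])
  have two: "2 \<le> card (nb w \<inter> nb u)"
    if uw: "u \<in> verts G" "w \<in> verts G" "u \<noteq> w" "w \<notin> nb u" for u w
  proof (rule ccontr)
    assume less: "\<not> 2 \<le> card (nb w \<inter> nb u)"
    have ex: "\<exists>z\<in>nb w \<inter> nb u. card {i, color G {u, z}, color G {w, z}} = 2"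
      if "i \<in> {1..t}" for i
      using sat that uw unfolding saturated_iff nb_def by fastforce
    obtain z where z: "z \<in> nb w \<inter> nb u" using ex[of 1] t by auto
    then have "card (nb w \<inter> nb u) = 1"
      using less finite_nb card_gt_0_iff[of "nb w \<inter> nb u"] by fastforce
    then have only: "nb w \<inter> nb u = {z}" using z by (metis card_1_singletonE singletonD)
    define p q where "p = color G {u, z}" and "q = color G {w, z}"
    have "p \<in> {1..t}" using z G by (auto simp: p_def edge_colored_def nb_def)
    moreover have "\<exists>j\<in>{1, 2, 3 :: nat}. j \<noteq> p \<and> j \<noteq> q" by auto
    then obtain j where "j \<in> {1, 2, 3 :: nat}" "j \<noteq> p" "j \<noteq> q" by blast
    ultimately have "(if p = q then p else j) \<in> {1..t}" "card {if p = q then p else j, p, q} \<noteq> 2"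
      using t by (auto simp: card_three_eq_2)
    then show False using ex only by (auto simp: p_def q_def)
  qed
  show "2 * card (verts G) - 4 \<le> card (edges G)"
    by (rule two_common_neighbors_bound(1)[OF two n])
  show "\<exists>D. D \<subseteq> verts G \<and> card D = 2 \<and> edges G = {{d, w} | d w. d \<in> D \<and> w \<in> verts G - D}"
    if "card (edges G) = 2 * card (verts G) - 4"
    by (rule two_common_neighbors_bound(2)[OF two n that])
qed

section \<open>The extremal coloring of a complete bipartite graph\<close>

text \<open>The extremal example, with sides \<open>{0, 1}\<close> and \<open>{2..<n}\<close>. Edges at \<open>0\<close> have color \<open>1\<close> and edges at \<open>1\<close> have
  color \<open>2\<close>, which handles all pairs in the large side. The edge between \<open>1\<close> and \<open>2\<close> is the exception with
  color \<open>1\<close>: it puts a monochromatic path between \<open>0\<close> and \<open>1\<close>, so that the pair can also be added in colors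
  other than \<open>1\<close> and \<open>2\<close>.\<close>

definition colored_K2 :: "nat \<Rightarrow> nat colored_graph" where
  "colored_K2 n = \<lparr>verts = {..<n}, edges = {{a, b} | a b. a \<in> {0, 1} \<and> b \<in> {2..<n}},
     color = (\<lambda>e. if 1 \<in> e \<and> 2 \<notin> e then 2 else 1)\<rparr>"

lemma card_colored_K2:
  assumes "2 \<le> n"
  shows "card (verts (colored_K2 n)) = n" "card (edges (colored_K2 n)) = 2 * n - 4"
  using card_edges_between[of "{0, 1 :: nat}" "{2..<n}"] assms by (auto simp: colored_K2_def)

lemma saturated_colored_K2:
  assumes "2 \<le> t" "4 \<le> n"
  shows "saturated (colorings_using t 2 (complete_graph 3)) t (colored_K2 n)"
proof -
  let ?G = "colored_K2 n"
  have E: "{a, b} \<in> edges ?G \<longleftrightarrow> a < 2 \<and> 2 \<le> b \<and> b < n \<or> b < 2 \<and> 2 \<le> a \<and> a < n" for a b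
    by (auto simp: colored_K2_def doubleton_eq_iff less_2_cases_iff)
  have V: "x \<in> verts ?G \<longleftrightarrow> x < n" for x by (simp add: colored_K2_def)
  have C: "color ?G {a, b} = (if (a = 1 \<or> b = 1) \<and> a \<noteq> 2 \<and> b \<noteq> 2 then 2 else 1)" for a b
    by (auto simp: colored_K2_def)
  have "edge_colored t ?G"
    using assms by (auto simp: edge_colored_def simple_graph_def colored_K2_def card_insert_if)
  moreover have "\<not> bichromatic_triangle ?G a b c" for a b c
    unfolding bichromatic_triangle_def E by linarith
  moreover have "\<exists>z. {u, z} \<in> edges ?G \<and> {w, z} \<in> edges ?G \<and>
      card {i, color ?G {u, z}, color ?G {w, z}} = 2"
    if uw: "u \<in> verts ?G" "w \<in> verts ?G" "u \<noteq> w" "{u, w} \<notin> edges ?G" for u w i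
  proof (cases "u < 2")
    case True
    then have "u = 0 \<and> w = 1 \<or> u = 1 \<and> w = 0" using uw unfolding E V by linarith
    then show ?thesis
      using assms unfolding E C card_three_eq_2
      \<comment> \<open>Vertex \<open>3\<close> gives a path with colors \<open>1\<close> and \<open>2\<close>, vertex \<open>2\<close> a path with color \<open>1\<close> only.\<close>
      by (intro exI[of _ "if i = 1 \<or> i = 2 then 3 else 2"]) auto
  next
    case False
    then have "2 \<le> w" using uw unfolding E V by linarith
    then show ?thesis
      using False uw assms unfolding E V C card_three_eq_2
      \<comment> \<open>Paths through \<open>0\<close> have color \<open>1\<close> only, and paths through \<open>1\<close> have an edge of color \<open>2\<close>.\<close>
      by (intro exI[of _ "if i = 1 then 1 else 0"]) auto
  qed
  ultimately show ?thesis by (simp add: saturated_iff)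
qed

lemma isomorphic_complete_bipartite_2:
  assumes "finite (verts G)" "card (verts G) = n" "D \<subseteq> verts G" "card D = 2"
    and E: "edges G = {{d, w} | d w. d \<in> D \<and> w \<in> verts G - D}"
  shows "graph_isomorphic G (complete_bipartite 2 (n - 2))"
proof -
  have finD: "finite D" using assms finite_subset by blast
  obtain f where f: "bij_betw f D {..<2::nat}"
    using finite_same_card_bij[of D "{..<2::nat}"] finD assms by auto
  have "card (verts G - D) = n - 2" using assms finD by (simp add: card_Diff_subset)
  then obtain g where g: "bij_betw g (verts G - D) {..<n - 2}"
    using finite_same_card_bij[of "verts G - D" "{..<n - 2}"] assms by auto
  define h where "h x = (if x \<in> D then Inl (f x) else Inr (g x))" for x
  have fD: "f ` D = {..<2}" and gW: "g ` (verts G - D) = {..<n - 2}"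
    using f g by (auto simp: bij_betw_def)
  have "inj_on h (verts G)"
    using f g by (auto simp: h_def inj_on_def bij_betw_def)
  moreover have "h ` verts G = h ` D \<union> h ` (verts G - D)" using assms(3) by auto
  then have "h ` verts G = Inl ` {..<2} \<union> Inr ` {..<n - 2}"
    unfolding fD[symmetric] gW[symmetric] by (simp add: h_def image_image)
  moreover have "(\<lambda>e. h ` e) ` edges G = edges (complete_bipartite 2 (n - 2))"
  proof -
    let ?W = "verts G - D"
    have "edges G = (\<lambda>(d, w). {d, w}) ` (D \<times> ?W)" unfolding E by auto
    then have "(\<lambda>e. h ` e) ` edges G = (\<lambda>(d, w). h ` {d, w}) ` (D \<times> ?W)"
      by (simp add: image_image case_prod_beta)
    also have "\<dots> = (\<lambda>(d, w). {Inl (f d), Inr (g w)}) ` (D \<times> ?W)"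
      by (rule image_cong) (auto simp: h_def)
    also have "\<dots> = (\<lambda>(i, j). {Inl i, Inr j}) ` (f ` D \<times> g ` ?W)"
      by (simp add: image_paired_Times[symmetric] image_image case_prod_beta)
    also have "\<dots> = edges (complete_bipartite 2 (n - 2))"
      unfolding fD gW by (auto simp: complete_bipartite_def)
    finally show ?thesis .
  qed
  ultimately show ?thesis
    unfolding graph_isomorphic_def by (intro exI[of _ h]) (simp add: bij_betw_def complete_bipartite_def)
qed

section \<open>The saturation number\<close>

theorem theorem8:
  fixes t n :: nat
  assumes "(t = 2 \<and> n \<ge> 11) \<or> (t \<ge> 3 \<and> n \<ge> 9)"
  shows "sat_number t n (colorings_using t 2 (complete_graph 3)) = enat (2 * n - 4) \<and>
    (t \<ge> 3 \<longrightarrow>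
      (\<forall>G :: 'a colored_graph.
         saturated (colorings_using t 2 (complete_graph 3)) t G \<and>
         card (verts G) = n \<and> card (edges G) = 2 * n - 4 \<longrightarrow>
         graph_isomorphic (graph.truncate G) (complete_bipartite 2 (n - 2))))"
proof (intro conjI impI allI)
  let ?C = "colorings_using t 2 (complete_graph 3)"
  have tn: "2 \<le> t" "4 \<le> n" using assms by auto
  show "sat_number t n ?C = enat (2 * n - 4)"
  proof (rule antisym)
    show "sat_number t n ?C \<le> enat (2 * n - 4)"
      unfolding sat_number_def
      by (rule INF_lower2[of "colored_K2 n"])
        (use saturated_colored_K2[OF tn] card_colored_K2[of n] tn in auto)
    show "enat (2 * n - 4) \<le> sat_number t n ?C"
      unfolding sat_number_def
    proof (rule INF_greatest)
      fix G :: "nat colored_graph"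
      assume "G \<in> {G. saturated ?C t G \<and> card (verts G) = n}"
      then have G: "saturated ?C t G" "card (verts G) = n" by auto
      show "enat (2 * n - 4) \<le> enat (card (edges G))"
        using assms
      proof
        assume "t = 2 \<and> n \<ge> 11"
        then show ?thesis using saturated_two_colors_lower_bound[of G] G by simp
      next
        assume "t \<ge> 3 \<and> n \<ge> 9"
        then show ?thesis using saturated_three_colors(1)[of t G] G by simp
      qed
    qed
  qed
next
  fix G :: "'a colored_graph"
  assume t: "3 \<le> t"
    and G: "saturated (colorings_using t 2 (complete_graph 3)) t G \<and>
      card (verts G) = n \<and> card (edges G) = 2 * n - 4"
  have n: "9 \<le> n" using t assms by auto
  have "finite (verts G)"
    using G by (simp add: saturated_iff edge_colored_def simple_graph_def)
  moreover obtain D where "D \<subseteq> verts G" "card D = 2"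
    "edges G = {{d, w} | d w. d \<in> D \<and> w \<in> verts G - D}"
    using saturated_three_colors(2)[of t G] t n G by auto
  ultimately show "graph_isomorphic (graph.truncate G) (complete_bipartite 2 (n - 2))"
    using G by (intro isomorphic_complete_bipartite_2[of _ n D]) (simp_all add: graph.truncate_def)
qed

end
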